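(* Let $Q$ be a finite homogeneous quandle, $e\in Q$, and let $G$ be a normal subgroup of $\mathrm{Aut}(Q)$ that is transitive on $Q$. Then $Q$ is latin if and only if for every $\alpha\in G\smallsetminus G_e$ the commutator $[R_e,\alpha]$ has no fixed points (on $Q$).
   Context: A quandle is a set $Q$ with a binary operation such that for every $x\in Q$ the right translation $R_x:Q\to Q$, $y\mapsto yx$, is an automorphism of $Q$, and $xx=x$ for all $x\in Q$. A quandle is homogeneous if $\mathrm{Aut}(Q)$ acts transitively on $Q$. A quandle is latin if all left translations $L_x:Q\to Q$, $y\mapsto xy$, are also permutations of $Q$. $G_e$ is the stabilizer of $e$ in $G$. Permutations act on the right (a product $\alpha\beta$ means first $\alpha$, then $\beta$), and $[\alpha,\beta]=\alpha^{-1}\beta^{-1}\alpha\beta$. *)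

theory Defs
  imports "HOL-Algebra.Bij" "HOL-Algebra.Coset" "HOL-Algebra.Group_Action"
begin

text \<open>
  Permutations of \<open>Q\<close> are the extensional bijections \<^term>\<open>Bij Q\<close>. They act on the right: in
  the group below \<open>f \<otimes> g\<close> means first \<open>f\<close>, then \<open>g\<close>, so its multiplication is the opposite of
  that of \<^const>\<open>BijGroup\<close>.
\<close>

definition Aut :: "'a set \<Rightarrow> ('a \<Rightarrow> 'a \<Rightarrow> 'a) \<Rightarrow> ('a \<Rightarrow> 'a) monoid" where
  "Aut Q m =
    \<lparr>carrier = {f \<in> Bij Q. \<forall>x\<in>Q. \<forall>y\<in>Q. f (m x y) = m (f x) (f y)},
     mult = (\<lambda>f g. compose Q g f),
     one = (\<lambda>x\<in>Q. x)\<rparr>"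

definition right_translation :: "'a set \<Rightarrow> ('a \<Rightarrow> 'a \<Rightarrow> 'a) \<Rightarrow> 'a \<Rightarrow> 'a \<Rightarrow> 'a" where
  "right_translation Q m x = (\<lambda>y\<in>Q. m y x)"

definition left_translation :: "'a set \<Rightarrow> ('a \<Rightarrow> 'a \<Rightarrow> 'a) \<Rightarrow> 'a \<Rightarrow> 'a \<Rightarrow> 'a" where
  "left_translation Q m x = (\<lambda>y\<in>Q. m x y)"

locale quandle =
  fixes Q :: "'a set" and m :: "'a \<Rightarrow> 'a \<Rightarrow> 'a"
  assumes closed: "\<lbrakk>x \<in> Q; y \<in> Q\<rbrakk> \<Longrightarrow> m x y \<in> Q"
    and right_translation_aut: "x \<in> Q \<Longrightarrow> right_translation Q m x \<in> carrier (Aut Q m)"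
    and idem: "x \<in> Q \<Longrightarrow> m x x = x"

definition transitive_on :: "('a \<Rightarrow> 'a) set \<Rightarrow> 'a set \<Rightarrow> bool" where
  "transitive_on G Q \<longleftrightarrow> (\<forall>x\<in>Q. \<forall>y\<in>Q. \<exists>g\<in>G. g x = y)"

locale homogeneous_quandle = quandle +
  assumes homogeneous: "transitive_on (carrier (Aut Q m)) Q"

definition latin :: "'a set \<Rightarrow> ('a \<Rightarrow> 'a \<Rightarrow> 'a) \<Rightarrow> bool" where
  "latin Q m \<longleftrightarrow> (\<forall>x\<in>Q. left_translation Q m x \<in> Bij Q)"

definition commutator :: "('g, 'b) monoid_scheme \<Rightarrow> 'g \<Rightarrow> 'g \<Rightarrow> 'g" where
  "commutator A a b = inv\<^bsub>A\<^esub> a \<otimes>\<^bsub>A\<^esub> inv\<^bsub>A\<^esub> b \<otimes>\<^bsub>A\<^esub> a \<otimes>\<^bsub>A\<^esub> b"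

lemma (in quandle) group_Aut: "group (Aut Q m)"
proof (rule groupI)
  fix f g assume "f \<in> carrier (Aut Q m)" "g \<in> carrier (Aut Q m)"
  then show "f \<otimes>\<^bsub>Aut Q m\<^esub> g \<in> carrier (Aut Q m)"
    using Bij_imp_funcset[of f Q] by (auto simp: Aut_def compose_Bij compose_eq closed Pi_iff)
next
  show "\<one>\<^bsub>Aut Q m\<^esub> \<in> carrier (Aut Q m)"
    by (simp add: Aut_def id_Bij closed)
next
  fix f g h
  assume "f \<in> carrier (Aut Q m)" "g \<in> carrier (Aut Q m)" "h \<in> carrier (Aut Q m)"
  then show "f \<otimes>\<^bsub>Aut Q m\<^esub> g \<otimes>\<^bsub>Aut Q m\<^esub> h = f \<otimes>\<^bsub>Aut Q m\<^esub> (g \<otimes>\<^bsub>Aut Q m\<^esub> h)"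
    using Bij_imp_funcset by (auto simp: Aut_def intro!: compose_assoc)
next
  fix f assume "f \<in> carrier (Aut Q m)"
  then show "\<one>\<^bsub>Aut Q m\<^esub> \<otimes>\<^bsub>Aut Q m\<^esub> f = f"
    by (auto simp: Aut_def Bij_def extensional_def compose_def fun_eq_iff)
next
  fix f assume f: "f \<in> carrier (Aut Q m)"
  define g where "g = (\<lambda>x\<in>Q. inv_into Q f x)"
  have fB: "f \<in> Bij Q" and hom: "\<And>x y. \<lbrakk>x \<in> Q; y \<in> Q\<rbrakk> \<Longrightarrow> f (m x y) = m (f x) (f y)"
    using f by (auto simp: Aut_def)
  have bij: "bij_betw f Q Q" using fB by (simp add: Bij_def)
  have gB: "g \<in> Bij Q" unfolding g_def by (rule restrict_inv_into_Bij[OF fB])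
  have gQ: "g x \<in> Q" if "x \<in> Q" for x using gB that Bij_imp_funcset by fastforce
  have fg: "f (g x) = x" if "x \<in> Q" for x
    using that bij by (simp add: g_def bij_betw_inv_into_right)
  have gf: "g (f x) = x" if "x \<in> Q" for x
    using that bij bij_betwE[OF bij] by (simp add: g_def bij_betw_inv_into_left)
  have "g (m x y) = m (g x) (g y)" if "x \<in> Q" "y \<in> Q" for x y
    using that hom[of "g x" "g y"] gf[of "m (g x) (g y)"] by (simp add: gQ fg closed)
  then have "g \<in> carrier (Aut Q m)" using gB by (simp add: Aut_def)
  moreover have "g \<otimes>\<^bsub>Aut Q m\<^esub> f = \<one>\<^bsub>Aut Q m\<^esub>"
    by (auto simp: Aut_def compose_def fg)
  ultimately show "\<exists>g\<in>carrier (Aut Q m). g \<otimes>\<^bsub>Aut Q m\<^esub> f = \<one>\<^bsub>Aut Q m\<^esub>" by blast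
qed

end

theory Submission
  imports Defs
begin

text \<open>
  Conjugating \<open>R\<^sub>e\<close> by \<open>\<alpha>\<close> gives \<open>R\<close> at \<open>\<alpha> e\<close>, so \<open>[R\<^sub>e, \<alpha>]\<close> maps \<open>ye\<close> to \<open>y(\<alpha> e)\<close>. Since \<open>R\<^sub>e\<close> is
  onto, \<open>[R\<^sub>e, \<alpha>]\<close> has a fixed point iff some \<open>L\<^sub>y\<close> identifies \<open>e\<close> with \<open>\<alpha> e\<close>. By transitivity of \<open>G\<close>,
  the points \<open>\<alpha> e\<close> range over all of \<open>Q - {e}\<close>, and any collision of a left translation can be moved
  to one that involves \<open>e\<close>.
\<close>

lemma Aut_mult_apply: "x \<in> Q \<Longrightarrow> (f \<otimes>\<^bsub>Aut Q m\<^esub> g) x = g (f x)"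
  by (simp add: Aut_def compose_eq)

lemma carrier_Aut_apply_mem: "\<lbrakk>f \<in> carrier (Aut Q m); x \<in> Q\<rbrakk> \<Longrightarrow> f x \<in> Q"
  using Bij_imp_funcset by (fastforce simp: Aut_def)

lemma carrier_Aut_bij_betw: "f \<in> carrier (Aut Q m) \<Longrightarrow> bij_betw f Q Q"
  by (simp add: Aut_def Bij_def)

lemma carrier_Aut_hom:
  "\<lbrakk>f \<in> carrier (Aut Q m); x \<in> Q; y \<in> Q\<rbrakk> \<Longrightarrow> f (m x y) = m (f x) (f y)"
  by (simp add: Aut_def)

context quandle
begin

text \<open>Pointwise this is the homomorphism law for \<alpha>. Keeping \<alpha> on both sides,
  rather than conjugating, avoids computing an inverse map.\<close>

lemma right_translation_mult_Aut:
  assumes "e \<in> Q" "\<alpha> \<in> carrier (Aut Q m)"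
  shows "right_translation Q m e \<otimes>\<^bsub>Aut Q m\<^esub> \<alpha> = \<alpha> \<otimes>\<^bsub>Aut Q m\<^esub> right_translation Q m (\<alpha> e)"
  using assms carrier_Aut_apply_mem[OF assms(2)] carrier_Aut_hom[OF assms(2)]
  by (auto simp: Aut_def compose_def right_translation_def fun_eq_iff)

text \<open>Reassociating the commutator leaves the inverse of the translation by \<open>e\<close>
  followed by its conjugate under \<alpha>; the previous lemma evaluates that conjugate.\<close>

lemma commutator_right_translation:
  assumes "e \<in> Q" "\<alpha> \<in> carrier (Aut Q m)"
  shows "commutator (Aut Q m) (right_translation Q m e) \<alpha> =
    inv\<^bsub>Aut Q m\<^esub> (right_translation Q m e) \<otimes>\<^bsub>Aut Q m\<^esub> right_translation Q m (\<alpha> e)"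
proof -
  interpret A: group "Aut Q m" by (rule group_Aut)
  have R: "right_translation Q m e \<in> carrier (Aut Q m)"
      "right_translation Q m (\<alpha> e) \<in> carrier (Aut Q m)"
    using assms by (auto intro: right_translation_aut carrier_Aut_apply_mem)
  have "inv\<^bsub>Aut Q m\<^esub> \<alpha> \<otimes>\<^bsub>Aut Q m\<^esub> (right_translation Q m e \<otimes>\<^bsub>Aut Q m\<^esub> \<alpha>) =
      right_translation Q m (\<alpha> e)"
    unfolding right_translation_mult_Aut[OF assms] using assms R
    by (simp add: A.m_assoc[symmetric])
  then show ?thesis using assms R by (simp add: commutator_def A.m_assoc)
qed

text \<open>Points are taken in the form \<open>m y e\<close> so that the leading inverse in the
  commutator cancels against the translation by \<open>e\<close>.\<close>

lemma commutator_apply: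
  assumes "e \<in> Q" "\<alpha> \<in> carrier (Aut Q m)" "y \<in> Q"
  shows "commutator (Aut Q m) (right_translation Q m e) \<alpha> (m y e) = m y (\<alpha> e)"
proof -
  interpret A: group "Aut Q m" by (rule group_Aut)
  let ?R = "right_translation Q m" and ?c = "commutator (Aut Q m) (right_translation Q m e) \<alpha>"
  have R: "?R e \<in> carrier (Aut Q m)" "?R (\<alpha> e) \<in> carrier (Aut Q m)"
    using assms by (auto intro: right_translation_aut carrier_Aut_apply_mem)
  have "?R e \<otimes>\<^bsub>Aut Q m\<^esub> ?c = ?R (\<alpha> e)"
    using R by (simp add: commutator_right_translation[OF assms(1,2)] A.m_assoc[symmetric])
  then have "?c (?R e y) = ?R (\<alpha> e) y"
    using Aut_mult_apply[OF assms(3), of m "?R e" ?c] by simp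
  then show ?thesis using assms(3) by (simp add: right_translation_def)
qed

lemma commutator_fixed_point_iff:
  assumes "e \<in> Q" "\<alpha> \<in> carrier (Aut Q m)"
  shows "(\<exists>x\<in>Q. commutator (Aut Q m) (right_translation Q m e) \<alpha> x = x) \<longleftrightarrow>
    (\<exists>y\<in>Q. m y (\<alpha> e) = m y e)"
proof -
  \<comment> \<open>Surjectivity of the translation by \<open>e\<close> lets every candidate fixed
    point be written as \<open>m y e\<close>.\<close>
  have "(\<lambda>y. m y e) ` Q = Q"
    using carrier_Aut_bij_betw[OF right_translation_aut[OF assms(1)]]
    by (auto simp: bij_betw_def right_translation_def)
  then have "(\<exists>x\<in>Q. P x) \<longleftrightarrow> (\<exists>x\<in>(\<lambda>y. m y e) ` Q. P x)" for P by simp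
  then have "(\<exists>x\<in>Q. P x) \<longleftrightarrow> (\<exists>y\<in>Q. P (m y e))" for P by simp
  from this[of "\<lambda>x. commutator (Aut Q m) (right_translation Q m e) \<alpha> x = x"]
  show ?thesis by (simp add: commutator_apply[OF assms])
qed

text \<open>On a finite set an injective self-map is onto, so only injectivity of left translations
  has to be checked.\<close>

lemma finite_latin_iff_cancel:
  assumes "finite Q"
  shows "latin Q m \<longleftrightarrow> (\<forall>y\<in>Q. \<forall>a\<in>Q. \<forall>b\<in>Q. m y a = m y b \<longrightarrow> a = b)"
proof -
  have "left_translation Q m y \<in> Bij Q \<longleftrightarrow> inj_on (m y) Q" if "y \<in> Q" for y
  proof -
    have "left_translation Q m y \<in> Bij Q \<longleftrightarrow> bij_betw (m y) Q Q"
      by (auto simp: Bij_def left_translation_def bij_betw_restrict_eq)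
    moreover have "m y ` Q \<subseteq> Q" using closed that by auto
    ultimately show ?thesis using endo_inj_surj[OF assms] by (auto simp: bij_betw_def)
  qed
  then show ?thesis by (auto simp: latin_def inj_on_def)
qed

end

theorem proposition6p2:
  fixes Q :: "'a set" and m :: "'a \<Rightarrow> 'a \<Rightarrow> 'a" and e :: 'a and G :: "('a \<Rightarrow> 'a) set"
  assumes "homogeneous_quandle Q m"
    and "finite Q"
    and "e \<in> Q"
    and "G \<lhd> Aut Q m"
    and "transitive_on G Q"
  shows "latin Q m \<longleftrightarrow>
    (\<forall>\<alpha> \<in> G - stabilizer (Aut Q m\<lparr>carrier := G\<rparr>) (\<lambda>g. g) e.
      \<not> (\<exists>x\<in>Q. commutator (Aut Q m) (right_translation Q m e) \<alpha> x = x))"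
proof -
  interpret homogeneous_quandle Q m by (rule assms(1))
  have GA: "g \<in> carrier (Aut Q m)" if "g \<in> G" for g
    using normal_imp_subgroup[OF assms(4)] that by (meson subgroup.mem_carrier)
  have GQ: "g x \<in> Q" if "g \<in> G" "x \<in> Q" for g x
    using carrier_Aut_apply_mem[OF GA[OF that(1)] that(2)] .
  have "(\<forall>\<alpha> \<in> G - stabilizer (Aut Q m\<lparr>carrier := G\<rparr>) (\<lambda>g. g) e.
      \<not> (\<exists>x\<in>Q. commutator (Aut Q m) (right_translation Q m e) \<alpha> x = x)) \<longleftrightarrow>
    (\<forall>\<alpha>\<in>G. \<forall>y\<in>Q. m y (\<alpha> e) = m y e \<longrightarrow> \<alpha> e = e)"
    \<comment> \<open>Lying outside the stabilizer means \<open>\<alpha> e \<noteq> e\<close>; the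
      right-hand side is the contrapositive.\<close>
    using commutator_fixed_point_iff[OF assms(3) GA] by (auto simp: stabilizer_def)
  also have "\<dots> \<longleftrightarrow> (\<forall>y\<in>Q. \<forall>a\<in>Q. \<forall>b\<in>Q. m y a = m y b \<longrightarrow> a = b)"
  proof (intro iffI ballI impI)
    fix y a b
    assume cancel: "\<forall>\<alpha>\<in>G. \<forall>y\<in>Q. m y (\<alpha> e) = m y e \<longrightarrow> \<alpha> e = e"
      and ab: "y \<in> Q" "a \<in> Q" "b \<in> Q" "m y a = m y b"
    \<comment> \<open>Applying \<open>g\<close> moves the collision of \<open>a\<close> and
      \<open>b\<close> under \<open>y\<close> to one of \<open>g a\<close> and \<open>e\<close>
      under \<open>g y\<close>; \<alpha> then presents \<open>g a\<close> as an image of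
      \<open>e\<close>.\<close>
    obtain g where g: "g \<in> G" "g b = e"
      using assms(3,5) ab(3) by (auto simp: transitive_on_def)
    obtain \<alpha> where \<alpha>: "\<alpha> \<in> G" "\<alpha> e = g a"
      using assms(3,5) GQ[OF g(1) ab(2)] by (auto simp: transitive_on_def)
    have "m (g y) (g a) = m (g y) (g b)"
      using carrier_Aut_hom[OF GA[OF g(1)]] ab by metis
    then have "g a = g b" using cancel \<alpha> g GQ[OF g(1) ab(1)] by metis
    then show "a = b"
      using carrier_Aut_bij_betw[OF GA[OF g(1)]] ab by (auto simp: bij_betw_def inj_on_def)
  \<comment> \<open>The converse is cancellation with \<open>a = \<alpha> e\<close> and
    \<open>b = e\<close>.\<close>
  qed (use assms(3) GQ in blast)
  finally show ?thesis using finite_latin_iff_cancel[OF assms(2)] by simp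
qed

end
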